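(* Let $l$ be a natural number, let $\mathbb{K}$ be a field and let $P(t)\in\mathbb{K}[t]$ be an irreducible polynomial of degree $d(P)$. Let $\Theta(t)=\sum_{i=1}^\infty b_it^{-i}\in\mathbb{K}((t^{-1}))$, and let $q=2$ if $\mathbb{K}$ is infinite and $q=\#\mathbb{K}$ if $\mathbb{K}$ is finite. Assume that $$\inf_{N(t)\in\mathbb{K}[t]\setminus\{0\}}|N(t)|\cdot|\langle N(t)\cdot\Theta(t)\rangle|\cdot|N(t)|_{t}=q^{-l}.$$ Then the Laurent series $\Theta(P(t))=\sum_{i=1}^\infty b_iP(t)^{-i}\in\mathbb{K}((P(t)^{-1}))\subset\mathbb{K}((t^{-1}))$ satisfies $$\inf_{N(t)\in\mathbb{K}[t]\setminus\{0\}}|N(t)|\cdot|\langle N(t)\cdot\Theta(P(t))\rangle|\cdot|N(t)|_{P(t)}=q^{-l\cdot d(P)}.$$ In particular, if the first infimum (for $\Theta(t)$, with the $t$-adic norm) is positive, then the second infimum (for $\Theta(P(t))$, with the $P(t)$-adic norm) is positive.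
   Context: $\mathbb{K}((t^{-1}))$ is the field of formal Laurent series $\Theta(t)=\sum_{i\ge -h}a_it^{-i}$ in $t^{-1}$ with coefficients in $\mathbb{K}$. If $a_{-h}\neq0$ the degree of $\Theta$ is $\deg\Theta=h$ and $|\Theta(t)|=q^{\deg\Theta}$ (with $|0|=0$), where $q=\#\mathbb{K}$ if $\mathbb{K}$ is finite and $q=2$ if $\mathbb{K}$ is infinite. The fractional part is $\langle\Theta(t)\rangle=\sum_{i\ge1}a_it^{-i}$. For an irreducible polynomial $P(t)\in\mathbb{K}[t]$ and nonzero $N(t)\in\mathbb{K}[t]$, the $P(t)$-adic norm is $|N(t)|_{P(t)}=|P(t)|^{-i}=q^{-i\deg P}$, where $i=\max\{j\ge0:P(t)^j\mid N(t)\}$; $|N(t)|_t$ is the case $P(t)=t$. *)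

theory Defs
  imports "HOL-Computational_Algebra.Computational_Algebra"
begin

unbundle fps_syntax

text \<open>
  The field of formal Laurent series in \<open>1/t\<close> is rendered by the library type \<^typ>\<open>'a fls\<close>, whose
  variable \<^const>\<open>fls_X\<close> stands for \<open>1/t\<close>. Hence \<open>f $$ i\<close> is the coefficient of \<open>t\<close> to the
  power \<open>-i\<close>, and the degree in \<open>t\<close> of a nonzero \<open>f\<close> is \<open>- fls_subdegree f\<close>.
\<close>

definition norm_base :: "'a itself \<Rightarrow> nat" where
  "norm_base _ = (if finite (UNIV :: 'a set) then card (UNIV :: 'a set) else 2)"

definition laurent_norm :: "'a::field fls \<Rightarrow> real" where
  "laurent_norm f =
     (if f = 0 then 0 else real (norm_base TYPE('a)) powi (- fls_subdegree f))"

lift_definition laurent_frac :: "'a::field fls \<Rightarrow> 'a fls"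
  is "\<lambda>f i. if i \<ge> 1 then f i else 0"
  by (auto simp: eventually_cofinite elim: rev_finite_subset)

text \<open>The embedding of polynomials: evaluation at \<open>t\<close>, which is \<^const>\<open>fls_X_inv\<close>.\<close>

definition laurent_of_poly :: "'a::field poly \<Rightarrow> 'a fls" where
  "laurent_of_poly p = poly (map_poly fls_const p) fls_X_inv"

definition adic_norm :: "'a::field poly \<Rightarrow> 'a poly \<Rightarrow> real" where
  "adic_norm P N = laurent_norm (laurent_of_poly P) powi (- int (Max {j. P ^ j dvd N}))"

text \<open>
  The series \<open>f(P(t))\<close>: since \<open>f\<close> is a series in \<open>1/t\<close>, one substitutes \<open>1/P(t)\<close> for the variable
  of \<open>f\<close>. For nonconstant \<open>P\<close>, \<open>1/P(t)\<close> has only positive powers of \<open>1/t\<close>, so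
  \<^const>\<open>fls_regpart\<close> merely views it as a power series; see \<open>sums_laurent_subst\<close> below.
\<close>

definition laurent_subst :: "'a::field fls \<Rightarrow> 'a poly \<Rightarrow> 'a fls" where
  "laurent_subst f P = fls_compose_fps f (fls_regpart (inverse (laurent_of_poly P)))"

definition adic_littlewood_inf :: "'a::field poly \<Rightarrow> 'a fls \<Rightarrow> real" where
  "adic_littlewood_inf P f =
     (INF N \<in> UNIV - {0}.
        laurent_norm (laurent_of_poly N) * laurent_norm (laurent_frac (laurent_of_poly N * f)) *
        adic_norm P N)"

lemma laurent_of_poly_nth:
  "laurent_of_poly p $$ i = (if i \<le> 0 then coeff p (nat (- i)) else 0)"
proof -
  have *: "fls_const c * fls_X_inv ^ n = fls_shift (int n) (fls_const (c::'a))" for c n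
    by (rule fls_X_inv_power_times_conv_shift(2))
  have "laurent_of_poly p = (\<Sum>n\<le>degree p. fls_const (coeff p n) * fls_X_inv ^ n)"
    unfolding laurent_of_poly_def
    by (subst poly_altdef) (simp add: degree_map_poly coeff_map_poly)
  also have "\<dots> $$ i = (\<Sum>n\<le>degree p. if n = nat (-i) \<and> i \<le> 0 then coeff p n else 0)"
    unfolding fls_nth_sum by (intro sum.cong) (auto simp: *)
  also have "\<dots> = (if i \<le> 0 then coeff p (nat (- i)) else 0)"
    by (auto simp: coeff_eq_0)
  finally show ?thesis .
qed

lemma laurent_of_poly_eq_0_iff: "laurent_of_poly p = 0 \<longleftrightarrow> p = 0"
proof
  assume "laurent_of_poly p = 0"
  hence "coeff p n = 0" for n
    using laurent_of_poly_nth[of p "- int n"] by simp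
  thus "p = 0" by (simp add: poly_eq_iff)
qed (simp add: laurent_of_poly_def)

lemma subdegree_laurent_of_poly: "fls_subdegree (laurent_of_poly p) = - int (degree p)"
proof (cases "p = 0")
  case False
  thus ?thesis
    by (intro fls_subdegree_eqI) (auto simp: laurent_of_poly_nth coeff_eq_0)
qed (simp add: laurent_of_poly_def)

lemma laurent_norm_of_poly:
  "N \<noteq> 0 \<Longrightarrow> laurent_norm (laurent_of_poly (N :: 'a::field poly)) =
     real (norm_base TYPE('a)) ^ degree N"
  by (simp add: laurent_norm_def laurent_of_poly_eq_0_iff subdegree_laurent_of_poly)

lemma finite_power_dvd:
  fixes P N :: "'a::field poly"
  assumes "degree P > 0" "N \<noteq> 0"
  shows "finite {j. P ^ j dvd N}"
proof (rule finite_subset)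
  show "{j. P ^ j dvd N} \<subseteq> {..degree N}"
  proof safe
    fix j assume "P ^ j dvd N"
    hence "degree P * j \<le> degree N"
      using dvd_imp_degree_le[of "P ^ j" N] assms degree_power_eq[of P j]
      by (fastforce simp: mult.commute)
    moreover have "1 * j \<le> degree P * j"
      using assms by (intro mult_right_mono) auto
    ultimately show "j \<le> degree N" by linarith
  qed
qed simp

lemma sums_laurent_subst:
  fixes f :: "'a::field fls"
  assumes f: "\<And>i. i \<le> 0 \<Longrightarrow> f $$ i = 0" and P: "degree P > 0"
  shows "(\<lambda>i. fls_const (f $$ int (Suc i)) * inverse (laurent_of_poly P) ^ Suc i)
           sums laurent_subst f P"
proof -
  define Y where "Y = fls_regpart (inverse (laurent_of_poly P))"
  have P0: "P \<noteq> 0" using P by auto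
  have sd: "fls_subdegree (inverse (laurent_of_poly P)) = int (degree P)"
    by (simp add: fls_inverse_subdegree subdegree_laurent_of_poly)
  have Y: "fps_to_fls Y = inverse (laurent_of_poly P)"
    unfolding Y_def using sd by (simp add: fls_regpart_to_fls_trivial)
  have Y0: "Y $ 0 = 0" unfolding Y_def using sd P by simp
  have Yn0: "Y \<noteq> 0" using Y P0 laurent_of_poly_eq_0_iff[of P] by auto
  define S where "S n = (\<Sum>i<n. fls_const (f $$ int (Suc i)) * fls_X ^ Suc i)" for n
  have cS: "fls_compose_fps (S n) Y =
      (\<Sum>i<n. fls_const (f $$ int (Suc i)) * inverse (laurent_of_poly P) ^ Suc i)" for n
    unfolding S_def
    by (induction n) (simp_all add: Y Y0 Yn0 fls_compose_fps_add fls_compose_fps_mult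
        fls_compose_fps_power del: power_Suc)
  have nthS: "S n $$ k = (if 1 \<le> k \<and> k \<le> int n then f $$ k else 0)" for n k
  proof -
    have "S n $$ k = (\<Sum>i<n. if i = nat (k - 1) \<and> 1 \<le> k then f $$ k else 0)"
      unfolding S_def fls_nth_sum
      by (intro sum.cong) (auto simp: fls_X_power_times_conv_shift mult.commute[of "fls_const _"]
            simp del: power_Suc)
    thus ?thesis by (auto)
  qed
  have deg: "fls_subdegree (laurent_subst f P - fls_compose_fps (S n) Y) \<ge> int (Suc n)"
    if ne: "laurent_subst f P \<noteq> fls_compose_fps (S n) Y" for n
  proof -
    define g where "g = f - S n"
    have eq: "laurent_subst f P - fls_compose_fps (S n) Y = fls_compose_fps g Y"
      using Y0 Yn0 by (simp add: g_def laurent_subst_def fls_compose_fps_diff flip: Y_def)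
    have g: "g \<noteq> 0" using ne eq by auto
    have gd: "fls_subdegree g \<ge> int (Suc n)"
      by (rule fls_subdegree_geI[OF g]) (auto simp: g_def nthS f)
    have "fls_compose_fps g Y \<noteq> 0" using eq ne by auto
    hence "fls_subdegree (fls_compose_fps g Y) = 
      fls_subdegree (fps_to_fls (fps_compose (fls_base_factor_to_fps g) Y)) + 
      fls_subdegree (fps_to_fls Y powi fls_subdegree g)"
      unfolding fls_compose_fps_def by (subst fls_subdegree_mult) auto
    also have "fls_subdegree (fps_to_fls Y powi fls_subdegree g) = int (degree P) * fls_subdegree g"
      using gd sd by (simp add: Y power_int_def fls_subdegree_pow)
    finally have "fls_subdegree (fls_compose_fps g Y) \<ge> int (degree P) * fls_subdegree g"
      by (simp add: fls_subdegree_fls_to_fps)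
    moreover have "1 * fls_subdegree g \<le> int (degree P) * fls_subdegree g"
      using P gd by (intro mult_right_mono) auto
    ultimately have "fls_subdegree (fls_compose_fps g Y) \<ge> int (Suc n)" using gd by linarith
    thus ?thesis using eq by simp
  qed
  show ?thesis
    unfolding sums_def cS[symmetric]
  proof (rule metric_LIMSEQ_I)
    fix e :: real assume e: "e > 0"
    obtain m where m: "inverse (2 ^ m) < e"
      using reals_power_lt_ex[OF e, of 2] by (auto simp: power_one_over inverse_eq_divide)
    show "\<exists>no. \<forall>n\<ge>no. dist (fls_compose_fps (S n) Y) (laurent_subst f P) < e"
    proof (intro exI allI impI)
      fix n assume n: "n \<ge> m"
      show "dist (fls_compose_fps (S n) Y) (laurent_subst f P) < e"
      proof (cases "laurent_subst f P = fls_compose_fps (S n) Y")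
        case False
        note d = deg[OF False]
        have "dist (laurent_subst f P) (fls_compose_fps (S n) Y) = 
            inverse (2 ^ nat (fls_subdegree (laurent_subst f P - fls_compose_fps (S n) Y)))"
          using False d by (simp add: dist_fls_def)
        also have "\<dots> \<le> inverse (2 ^ m)"
          using n d by (intro le_imp_inverse_le power_increasing) auto
        finally show ?thesis using m by (simp add: dist_commute)
      qed (use e in simp)
    qed
  qed
qed

end

theory Submission
  imports Defs
begin

text \<open>
  Put \<open>d = degree P\<close> and write \<open>N = (\<Sum>k<d. t\<^sup>k N\<^sub>k(P))\<close> by expanding \<open>N\<close> in base \<open>P\<close>. The fractional part of
  \<open>N \<Theta>(P)\<close> is then \<open>(\<Sum>k<d. t\<^sup>k \<langle>N\<^sub>k \<Theta>\<rangle>(P))\<close>. In both sums the nonzero summands have degrees that are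
  pairwise distinct modulo \<open>d\<close>, so nothing cancels and every summand bounds the degree of the sum
  from below. Removing from \<open>N\<close> the exact power \<open>P\<^sup>i\<close> that divides it, one finds an \<open>m\<close> with \<open>t\<^sup>i\<close> the
  exact power of \<open>t\<close> dividing \<open>N\<^sub>m\<close>; the lower bound for \<open>N\<^sub>m\<close> and \<open>\<Theta>\<close>, raised to the power \<open>d\<close>, is a
  lower bound for \<open>N\<close> and \<open>\<Theta>(P)\<close>. Conversely, all values are integral powers of \<open>q\<close> or zero, so the
  infimum is attained for \<open>\<Theta>\<close> at some \<open>N\<close>, and \<open>N(P)\<close> attains the bound for \<open>\<Theta>(P)\<close>.
\<close>

section \<open>Polynomials inside the Laurent series, and the fractional part\<close>

lemma laurent_of_poly_0 [simp]: "laurent_of_poly 0 = 0"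
  by (simp add: laurent_of_poly_eq_0_iff)

lemma laurent_of_poly_add: "laurent_of_poly (p + r) = laurent_of_poly p + laurent_of_poly r"
  by (simp add: fls_eq_iff laurent_of_poly_nth)

lemma laurent_of_poly_pCons:
  "laurent_of_poly (pCons a p) = fls_const a + fls_X_inv * laurent_of_poly p"
  by (simp add: laurent_of_poly_def map_poly_pCons)

lemma laurent_of_poly_smult: "laurent_of_poly (smult a p) = fls_const a * laurent_of_poly p"
  by (simp add: fls_eq_iff laurent_of_poly_nth)

lemma laurent_of_poly_mult: "laurent_of_poly (p * r) = laurent_of_poly p * laurent_of_poly r"
  by (induction p)
    (simp_all add: laurent_of_poly_add laurent_of_poly_smult laurent_of_poly_pCons algebra_simps)

lemma laurent_of_poly_monom: "laurent_of_poly (monom 1 k) = fls_X_inv ^ k"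
  by (simp add: laurent_of_poly_def map_poly_monom poly_monom)

lemma laurent_of_poly_sum: "laurent_of_poly (\<Sum>k\<in>A. f k) = (\<Sum>k\<in>A. laurent_of_poly (f k))"
  by (induction A rule: infinite_finite_induct) (simp_all add: laurent_of_poly_add)

lemma laurent_frac_nth: "laurent_frac f $$ i = (if i \<ge> 1 then f $$ i else 0)"
  by transfer simp

lemma laurent_frac_add: "laurent_frac (f + g) = laurent_frac f + laurent_frac g"
  by (simp add: fls_eq_iff laurent_frac_nth)

lemma laurent_frac_sum: "laurent_frac (\<Sum>k\<in>A. f k) = (\<Sum>k\<in>A. laurent_frac (f k))"
  by (simp add: fls_eq_iff laurent_frac_nth fls_nth_sum)

lemma laurent_frac_of_poly: "laurent_frac (laurent_of_poly p) = 0"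
  by (simp add: fls_eq_iff laurent_frac_nth laurent_of_poly_nth)

lemma laurent_frac_idem:
  assumes "\<And>i. i \<le> 0 \<Longrightarrow> f $$ i = 0"
  shows "laurent_frac f = f"
  using assms by (auto simp: fls_eq_iff laurent_frac_nth)

lemma laurent_frac_decompose:
  obtains p where "f = laurent_of_poly p + laurent_frac f"
proof
  \<comment> \<open>\<open>f\<close> has no term of degree above \<open>n\<close> in t, so
    \<open>p\<close> collects all its nonnegative powers of t.\<close>
  define n where "n = nat (- fls_subdegree f)"
  define p where "p = (\<Sum>k\<le>n. monom (f $$ (- int k)) k)"
  have "coeff p k = f $$ (- int k)" for k
    unfolding p_def coeff_sum n_def by (auto intro!: fls_eq0_below_subdegree)
  then show "f = laurent_of_poly p + laurent_frac f"
    by (auto simp: fls_eq_iff laurent_of_poly_nth laurent_frac_nth)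
qed

text \<open>These are the side conditions for composing with 1/P. The regular part loses nothing,
  since 1/P starts at the positive exponent \<open>degree P\<close>.\<close>

lemma inverse_laurent_of_poly:
  assumes "degree P > 0"
  defines "Y \<equiv> fls_regpart (inverse (laurent_of_poly P))"
  shows "fps_to_fls Y = inverse (laurent_of_poly P)" "Y $ 0 = 0" "Y \<noteq> 0" "subdegree Y = degree P"
proof -
  have sd: "fls_subdegree (inverse (laurent_of_poly P)) = int (degree P)"
    by (simp add: fls_inverse_subdegree subdegree_laurent_of_poly)
  show Y: "fps_to_fls Y = inverse (laurent_of_poly P)"
    unfolding Y_def using sd by (simp add: fls_regpart_to_fls_trivial)
  show "Y $ 0 = 0" unfolding Y_def using sd assms by simp
  show "Y \<noteq> 0" using Y assms laurent_of_poly_eq_0_iff[of P] by auto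
  show "subdegree Y = degree P"
    using sd Y by (metis fls_subdegree_fls_to_fps of_nat_eq_iff)
qed

section \<open>Substitution of \<open>P\<close> for t, and expansion in base
  \<open>P\<close>\<close>

context
  fixes P :: "'a::field poly"
  assumes P: "degree P > 0"
begin

lemmas inverse_P = inverse_laurent_of_poly[OF P]

lemma laurent_subst_0 [simp]: "laurent_subst 0 P = 0"
  by (simp add: laurent_subst_def)

lemma laurent_subst_add: "laurent_subst (f + g) P = laurent_subst f P + laurent_subst g P"
  using inverse_P by (simp add: laurent_subst_def fls_compose_fps_add)

lemma laurent_subst_mult: "laurent_subst (f * g) P = laurent_subst f P * laurent_subst g P"
  using inverse_P by (simp add: laurent_subst_def fls_compose_fps_mult)

lemma laurent_subst_of_poly: "laurent_subst (laurent_of_poly p) P = laurent_of_poly (pcompose p P)"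
proof (induction p)
  case (pCons a p)
  have "laurent_subst fls_X_inv P = laurent_of_poly P"
    using inverse_P fls_compose_fps_inverse[of "fls_regpart (inverse (laurent_of_poly P))" fls_X]
    by (simp add: laurent_subst_def fls_inverse_X)
  moreover have "laurent_subst (fls_const a) P = fls_const a"
    by (simp add: laurent_subst_def)
  moreover have "laurent_of_poly [:a:] = fls_const a"
    by (simp add: laurent_of_poly_pCons)
  ultimately show ?case using pCons.IH
    by (simp add: laurent_of_poly_pCons pcompose_pCons laurent_subst_add laurent_subst_mult
        laurent_of_poly_add laurent_of_poly_mult)
qed simp

lemma laurent_subst_eq_0_iff: "laurent_subst f P = 0 \<longleftrightarrow> f = 0"
  using inverse_P by (simp add: laurent_subst_def fls_compose_fps_eq_0_iff)

lemma subdegree_laurent_subst: "fls_subdegree (laurent_subst f P) = int (degree P) * fls_subdegree f"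
  using inverse_P P by (simp add: laurent_subst_def mult.commute)

lemma laurent_subst_nth_eq_0:
  assumes "i < int (degree P) * n" "\<And>j. j < n \<Longrightarrow> f $$ j = 0"
  shows "laurent_subst f P $$ i = 0"
proof (cases "f = 0")
  case False
  then have "n \<le> fls_subdegree f" using assms(2) by (intro fls_subdegree_geI)
  then have "int (degree P) * n \<le> int (degree P) * fls_subdegree f" by (intro mult_left_mono) auto
  then show ?thesis using assms(1) by (intro fls_eq0_below_subdegree) (simp add: subdegree_laurent_subst)
qed simp

text \<open>Split \<open>f\<close> into polynomial and fractional part. The first yields a
  polynomial, which has no fractional part. The second yields exponents of 1/t that are at least
  \<open>degree P\<close>, and a factor t^k with smaller k keeps them positive.\<close>

lemma laurent_frac_twisted_subst:
  assumes "k < degree P"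
  shows "laurent_frac (fls_X_inv ^ k * laurent_subst f P) =
    fls_X_inv ^ k * laurent_subst (laurent_frac f) P"
proof -
  obtain p where p: "f = laurent_of_poly p + laurent_frac f" by (rule laurent_frac_decompose)
  have "fls_X_inv ^ k * laurent_subst f P = laurent_of_poly (monom 1 k * pcompose p P) +
      fls_X_inv ^ k * laurent_subst (laurent_frac f) P"
    by (subst p) (simp add: laurent_subst_add laurent_subst_of_poly laurent_of_poly_mult
        laurent_of_poly_monom algebra_simps)
  moreover have "laurent_frac (fls_X_inv ^ k * laurent_subst (laurent_frac f) P) =
      fls_X_inv ^ k * laurent_subst (laurent_frac f) P"
  proof (rule laurent_frac_idem)
    fix i :: int assume "i \<le> 0"
    then have "laurent_subst (laurent_frac f) P $$ (i + int k) = 0"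
      using assms by (intro laurent_subst_nth_eq_0[where n = 1]) (auto simp: laurent_frac_nth)
    then show "(fls_X_inv ^ k * laurent_subst (laurent_frac f) P) $$ i = 0"
      by (simp add: fls_X_inv_power_times_conv_shift)
  qed
  ultimately show ?thesis
    by (simp add: laurent_frac_add laurent_frac_of_poly)
qed

text \<open>The degree in t of a nonzero k-th summand is congruent to k modulo
  \<open>degree P\<close>, so the nonzero summands have different degrees and the leading term of
  the largest one survives.\<close>

lemma twisted_sum_subdegree_le:
  fixes g :: "nat \<Rightarrow> 'a fls"
  defines "F \<equiv> (\<Sum>k<degree P. fls_X_inv ^ k * laurent_subst (g k) P)"
  assumes m: "m < degree P" "g m \<noteq> 0"
  shows "F \<noteq> 0" "fls_subdegree F \<le> int (degree P) * fls_subdegree (g m) - int m"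
proof -
  \<comment> \<open>For nonzero \<open>g k\<close>, \<open>s k\<close> is the subdegree of the k-th
    summand; \<open>n\<close> will minimize it.\<close>
  define s where "s k = int (degree P) * fls_subdegree (g k) - int k" for k
  define T where "T = {k. k < degree P \<and> g k \<noteq> 0}"
  have T: "finite T" "m \<in> T" unfolding T_def using m by auto
  then obtain n where n: "n \<in> T" "\<And>k. k \<in> T \<Longrightarrow> s n \<le> s k"
    using ex_min_if_finite[of "s ` T"] by (metis empty_iff arg_min_if_finite(1) arg_min_least)
  have inj: "k = n" if "k < degree P" "s k = s n" for k
  proof -
    have "(int k - int n) = int (degree P) * (fls_subdegree (g k) - fls_subdegree (g n))"
      using that(2) by (simp add: s_def algebra_simps)
    then have "int (degree P) dvd int k - int n" by simp
    moreover have "\<bar>int k - int n\<bar> < int (degree P)" using that(1) n(1) by (auto simp: T_def)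
    ultimately show ?thesis using zdvd_imp_le[of "int (degree P)" "\<bar>int k - int n\<bar>"] by auto
  qed
  have nth: "(fls_X_inv ^ k * laurent_subst (g k) P) $$ i = laurent_subst (g k) P $$ (i + int k)" for k i
    by (simp add: fls_X_inv_power_times_conv_shift)
  have "laurent_subst (g k) P $$ (s n + int k) = 0" if k: "k < degree P" "k \<noteq> n" for k
  proof (cases "k \<in> T")
    case True
    then have "s n < s k" using n(2)[OF True] inj[OF k(1)] k(2) by linarith
    then show ?thesis
      by (intro fls_eq0_below_subdegree) (simp add: subdegree_laurent_subst s_def)
  qed (use k in \<open>simp add: T_def\<close>)
  then have "F $$ s n = (\<Sum>k<degree P. if k = n then laurent_subst (g n) P $$ (s n + int n) else 0)"
    unfolding F_def fls_nth_sum nth by (intro sum.cong) auto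
  also have "\<dots> = laurent_subst (g n) P $$ (s n + int n)"
    using n(1) by (simp add: T_def)
  also have "s n + int n = fls_subdegree (laurent_subst (g n) P)"
    by (simp add: s_def subdegree_laurent_subst)
  finally have "F $$ s n \<noteq> 0"
    using n(1) by (simp add: T_def laurent_subst_eq_0_iff)
  then show "F \<noteq> 0" and "fls_subdegree F \<le> int (degree P) * fls_subdegree (g m) - int m"
    using n(2)[OF T(2)] fls_subdegree_leI[of F "s n"] by (auto simp: s_def)
qed

text \<open>Induction by division by \<open>P\<close>: multiplying by \<open>P\<close> multiplies
  each \<open>M k\<close> by the variable, so \<open>pCons\<close> shifts the digits of the quotient
  and puts coefficient k of the remainder in as the new constant term.\<close>

lemma base_expansion:
  obtains M where "N = (\<Sum>k<degree P. monom 1 k * pcompose (M k) P)"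
proof -
  have "\<exists>M. N = (\<Sum>k<degree P. monom 1 k * pcompose (M k) P)"
  proof (induction "degree N" arbitrary: N rule: less_induct)
    case less
    have digits: "R = (\<Sum>k<degree P. monom 1 k * [:coeff R k:])" if "degree R < degree P"
      for R :: "'a poly"
    proof -
      have "coeff R i = 0" if "degree P \<le> i" for i
        using that \<open>degree R < degree P\<close> by (intro coeff_eq_0) auto
      then show ?thesis
        by (auto simp: poly_eq_iff coeff_sum mult.commute[of "monom _ _"] smult_monom)
    qed
    show ?case
    proof (cases "degree N < degree P")
      case True
      then show ?thesis by (intro exI[of _ "\<lambda>k. [:coeff N k:]"]) (use digits[OF True] in simp)
    next
      case False
      define R where "R = N mod P"
      have R: "degree R < degree P"
        using P degree_mod_less'[of P N] by (cases "N mod P = 0"; cases "P = 0") (auto simp: R_def)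
      have "degree (N div P) < degree N"
        using P False by (intro degree_div_less) auto
      then obtain M where M: "N div P = (\<Sum>k<degree P. monom 1 k * pcompose (M k) P)"
        using less by blast
      have "N = R + P * (N div P)" by (simp add: R_def)
      also have "\<dots> = (\<Sum>k<degree P. monom 1 k * pcompose (pCons (coeff R k) (M k)) P)"
        by (subst digits[OF R]) (simp add: M pcompose_pCons sum_distrib_left algebra_simps
            flip: sum.distrib)
      finally show ?thesis by (rule exI[of _ "\<lambda>k. pCons (coeff R k) (M k)"])
    qed
  qed
  then show ?thesis using that by blast
qed

end

section \<open>Exact powers dividing a polynomial\<close>

lemma pcompose_power: "pcompose (p ^ n) r = pcompose p r ^ n"
  for p r :: "'a::comm_semiring_1 poly"
  by (induction n) (simp_all add: pcompose_mult one_pCons)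

text \<open>This evaluates the exponent in \<open>adic_norm\<close>: one more factor
  \<open>P\<close> would, after cancelling \<open>P ^ i\<close>, divide \<open>M\<close>.\<close>

lemma Max_power_dvd:
  fixes P M :: "'a::field poly"
  assumes "degree P > 0" "\<not> P dvd M"
  shows "Max {j. P ^ j dvd P ^ i * M} = i"
proof (rule Max_eqI)
  have P0: "P \<noteq> 0" using assms by auto
  show "finite {j. P ^ j dvd P ^ i * M}"
    using assms P0 by (intro finite_power_dvd) auto
  fix j assume "j \<in> {j. P ^ j dvd P ^ i * M}"
  then have j: "P ^ j dvd P ^ i * M" by simp
  show "j \<le> i"
  proof (rule ccontr)
    assume "\<not> j \<le> i"
    then have "P ^ Suc i dvd P ^ i * M" using j by (meson dvd_trans le_imp_power_dvd not_less_eq_eq)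
    then have "P ^ i * P dvd P ^ i * M" by (simp add: mult.commute)
    then show False using assms P0 by (simp add: dvd_mult_cancel_left)
  qed
qed simp

lemma power_dvd_decompose:
  fixes P N :: "'a::field poly"
  assumes "degree P > 0" "N \<noteq> 0"
  obtains i M where "N = P ^ i * M" "\<not> P dvd M"
proof -
  define i where "i = Max {j. P ^ j dvd N}"
  have fin: "finite {j. P ^ j dvd N}" using assms by (rule finite_power_dvd)
  have "0 \<in> {j. P ^ j dvd N}" by simp
  with fin have "i \<in> {j. P ^ j dvd N}" unfolding i_def by (intro Max_in) blast+
  then obtain M where M: "N = P ^ i * M" by (auto elim: dvdE)
  have "\<not> P dvd M"
  proof
    assume "P dvd M"
    then have "Suc i \<in> {j. P ^ j dvd N}" by (auto simp: M elim!: dvdE)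
    then have "Suc i \<le> i" unfolding i_def using fin by (intro Max_ge)
    then show False by simp
  qed
  with M that show ?thesis by blast
qed

section \<open>The products under the infimum, as powers of q\<close>

lemma power_int_le_iff:
  fixes q :: "'a::linordered_field"
  assumes "q > 1"
  shows "q powi a \<le> q powi b \<longleftrightarrow> a \<le> b"
  using power_int_increasing[of a b q] power_int_strict_increasing[of b a q] assms
  by (metis less_imp_le not_le)

lemma norm_base_gt_1: "norm_base TYPE('a::field) > 1"
proof (cases "finite (UNIV :: 'a set)")
  case True
  then have "card {0, 1 :: 'a} \<le> card (UNIV :: 'a set)" by (intro card_mono) auto
  then show ?thesis using True by (simp add: norm_base_def)
qed (simp add: norm_base_def)

definition littlewood_product :: "'a::field poly \<Rightarrow> 'a fls \<Rightarrow> 'a poly \<Rightarrow> real" where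
  "littlewood_product P f N =
     laurent_norm (laurent_of_poly N) * laurent_norm (laurent_frac (laurent_of_poly N * f)) *
     adic_norm P N"

text \<open>Each factor is a power of q, or zero when the fractional part is; comparing products
  thus reduces to comparing exponents.\<close>

lemma littlewood_product_eq:
  fixes P N :: "'a::field poly" and f :: "'a fls"
  assumes P: "degree P > 0" and N: "N = P ^ i * M" "\<not> P dvd M"
  defines "h \<equiv> laurent_frac (laurent_of_poly N * f)"
  shows "littlewood_product P f N = (if h = 0 then 0 else
    real (norm_base TYPE('a)) powi
      (int (degree N) - fls_subdegree h - int (degree P) * int i))"
proof -
  have ne: "N \<noteq> 0" "P \<noteq> 0" using P N by auto
  have q: "real (norm_base TYPE('a)) \<noteq> 0" using norm_base_gt_1[where 'a = 'a] by simp
  have "adic_norm P N = real (norm_base TYPE('a)) powi (- (int (degree P) * int i))"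
    unfolding adic_norm_def N(1) Max_power_dvd[OF P N(2)]
    by (simp add: laurent_norm_of_poly ne power_int_minus flip: power_mult of_nat_mult)
  then show ?thesis
    using q
    by (simp add: littlewood_product_def laurent_norm_of_poly ne laurent_norm_def[of h] power_int_diff
        power_int_minus divide_simps flip: h_def)
qed

lemma littlewood_product_nonneg: "littlewood_product P f N \<ge> 0"
  by (simp add: littlewood_product_def laurent_norm_def adic_norm_def)

lemma adic_littlewood_inf_eq: "adic_littlewood_inf P f = (INF N \<in> UNIV - {0}. littlewood_product P f N)"
  by (simp add: adic_littlewood_inf_def littlewood_product_def)

lemma adic_littlewood_inf_le:
  assumes "N \<noteq> 0"
  shows "adic_littlewood_inf P f \<le> littlewood_product P f N"
  unfolding adic_littlewood_inf_eq using assms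
  by (intro cINF_lower bdd_belowI2[of _ 0] littlewood_product_nonneg) auto

lemma le_adic_littlewood_inf:
  fixes P :: "'a::field poly"
  assumes "\<And>N. N \<noteq> 0 \<Longrightarrow> c \<le> littlewood_product P f N"
  shows "c \<le> adic_littlewood_inf P f"
  unfolding adic_littlewood_inf_eq using assms
  \<comment> \<open>The polynomial 1 shows that the index set is nonempty.\<close>
  by (intro cINF_greatest) (use one_neq_zero in blast)+

text \<open>One well-chosen base-\<open>P\<close> digit of \<open>N\<close> suffices: by
  \<open>twisted_sum_subdegree_le\<close> its own product bounds the one for
  \<open>N\<close>.\<close>

lemma littlewood_product_subst_ge:
  fixes P :: "'a::field poly" and f :: "'a fls" and l :: nat
  defines "q \<equiv> real (norm_base TYPE('a))"
  assumes P: "degree P > 0"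
    and le: "\<And>N. N \<noteq> 0 \<Longrightarrow> q powi (- int l) \<le> littlewood_product [:0, 1:] f N"
    and "N \<noteq> 0"
  shows "q powi (- int (l * degree P)) \<le> littlewood_product P (laurent_subst f P) N"
proof -
  have q: "q > 1" using norm_base_gt_1[where 'a = 'a] by (simp add: q_def)
  have pos: "0 < q powi (- int l)" using q by simp
  obtain i M where N: "N = P ^ i * M" "\<not> P dvd M" using power_dvd_decompose[OF P \<open>N \<noteq> 0\<close>] .
  obtain R where R: "M = (\<Sum>k<degree P. monom 1 k * pcompose (R k) P)" using base_expansion[OF P] .
  \<comment> \<open>Composition with \<open>P\<close> turns the factor t^i into
    \<open>P ^ i\<close>, so the \<open>S k\<close> are digits of \<open>N\<close> itself.\<close>
  define S where "S k = [:0, 1:] ^ i * R k" for k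
  have "pcompose (S k) P = P ^ i * pcompose (R k) P" for k
    by (simp add: S_def pcompose_mult pcompose_power pcompose_pCons)
  then have NS: "N = (\<Sum>k<degree P. monom 1 k * pcompose (S k) P)"
    by (simp add: N R sum_distrib_left algebra_simps)
  \<comment> \<open>If t divided every \<open>R k\<close>, then \<open>P\<close> would divide each
    composed digit and hence \<open>M\<close>.\<close>
  obtain m where m: "m < degree P" "\<not> [:0, 1:] dvd R m"
  proof (rule ccontr)
    assume "\<not> thesis"
    with that have "[:0, 1:] dvd R k" if "k < degree P" for k using \<open>k < degree P\<close> by blast
    then have "P dvd pcompose (R k) P" if "k < degree P" for k
      using that by (fastforce simp: pcompose_mult pcompose_pCons elim!: dvdE)
    then have "P dvd M" unfolding R by (intro dvd_sum) auto
    with N(2) show False by contradiction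
  qed
  have Sm: "S m \<noteq> 0" using m(2) by (auto simp: S_def)
  define h where "h k = laurent_frac (laurent_of_poly (S k) * f)" for k
  have prod_eq: "littlewood_product [:0, 1:] f (S m) = (if h m = 0 then 0 else
      q powi (int (degree (S m)) - fls_subdegree (h m) - int i))"
    using littlewood_product_eq[OF _ _ m(2), of "S m" i f] by (simp add: S_def h_def q_def)
  have hm: "h m \<noteq> 0"
  proof
    assume "h m = 0"
    then have "littlewood_product [:0, 1:] f (S m) = 0" by (simp add: prod_eq)
    with le[OF Sm] pos show False by linarith
  qed
  with prod_eq le[OF Sm] q have "- int l \<le> int (degree (S m)) - fls_subdegree (h m) - int i"
    by (simp add: power_int_le_iff)
  then have exponent: "- int (l * degree P) \<le>
      int (degree P) * (int (degree (S m)) - fls_subdegree (h m) - int i)"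
    using mult_left_mono[of "- int l" "int (degree (S m)) - fls_subdegree (h m) - int i"
        "int (degree P)"] by (simp add: mult.commute)
  have N_eq: "laurent_of_poly N =
      (\<Sum>k<degree P. fls_X_inv ^ k * laurent_subst (laurent_of_poly (S k)) P)"
    by (simp add: NS laurent_of_poly_sum laurent_of_poly_mult laurent_of_poly_monom
        laurent_subst_of_poly[OF P])
  have deg: "int (degree P) * int (degree (S m)) + int m \<le> int (degree N)"
    using twisted_sum_subdegree_le(2)[OF P m(1), of "\<lambda>k. laurent_of_poly (S k)"] Sm
    by (simp add: laurent_of_poly_eq_0_iff subdegree_laurent_of_poly flip: N_eq)
  define H where "H = laurent_frac (laurent_of_poly N * laurent_subst f P)"
  have "laurent_of_poly N * laurent_subst f P =
      (\<Sum>k<degree P. fls_X_inv ^ k * laurent_subst (laurent_of_poly (S k) * f) P)"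
    by (simp add: N_eq laurent_subst_mult[OF P] sum_distrib_right mult.assoc)
  then have "H = (\<Sum>k<degree P. fls_X_inv ^ k * laurent_subst (h k) P)"
    by (simp add: H_def h_def laurent_frac_sum laurent_frac_twisted_subst[OF P])
  then have "H \<noteq> 0" "fls_subdegree H \<le> int (degree P) * fls_subdegree (h m) - int m"
    using twisted_sum_subdegree_le[OF P m(1), of h] hm by auto
  \<comment> \<open>The shift by \<open>m\<close> helps in both degree estimates: the exponent for
    \<open>N\<close> is at least \<open>degree P\<close> times that for \<open>S m\<close>, plus
    \<open>2 * m\<close>, which is dropped.\<close>
  with exponent deg have "H \<noteq> 0"
    "- int (l * degree P) \<le> int (degree N) - fls_subdegree H - int (degree P) * int i"
    by (auto simp: algebra_simps)
  then show ?thesis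
    using littlewood_product_eq[OF P N, of "laurent_subst f P"] q
    by (simp add: power_int_le_iff flip: H_def q_def)
qed

text \<open>Substitution multiplies all three exponents by \<open>degree P\<close>. This supplies
  the upper bound for the infimum of the substituted series.\<close>

lemma littlewood_product_subst_pcompose:
  fixes P :: "'a::field poly"
  assumes P: "degree P > 0" and "N \<noteq> 0"
  shows "littlewood_product P (laurent_subst f P) (pcompose N P) =
    littlewood_product [:0, 1:] f N ^ degree P"
proof -
  let ?q = "real (norm_base TYPE('a))"
  obtain i M where N: "N = [:0, 1:] ^ i * M" "\<not> [:0, 1:] dvd M"
    using power_dvd_decompose[of "[:0, 1:]" N] \<open>N \<noteq> 0\<close> by auto
  have NP: "pcompose N P = P ^ i * pcompose M P"
    by (simp add: N pcompose_mult pcompose_power pcompose_pCons)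
  obtain a M' where M: "M = pCons a M'" by (cases M)
  \<comment> \<open>Modulo \<open>P\<close>, the composition \<open>pcompose M P\<close> reduces to
    the constant coefficient \<open>a\<close> of \<open>M\<close>, so \<open>P\<close> does not
    divide it once \<open>a\<close> is nonzero.\<close>
  have "a \<noteq> 0"
  proof
    assume "a = 0"
    then have "M = [:0, 1:] * M'" by (simp add: M)
    then show False using N(2) dvd_triv_left by metis
  qed
  then have "\<not> P dvd [:a:]" using P dvd_imp_degree_le[of P "[:a:]"] by auto
  then have ndvd: "\<not> P dvd pcompose M P" by (simp add: M pcompose_pCons dvd_add_left_iff)
  define h where "h = laurent_frac (laurent_of_poly N * f)"
  \<comment> \<open>This is the case k = 0: the second \<open>P\<close> in \<open>OF\<close> states
    0 < \<open>degree P\<close>.\<close>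
  have frac: "laurent_frac (laurent_of_poly (pcompose N P) * laurent_subst f P) = laurent_subst h P"
    using laurent_frac_twisted_subst[OF P P, of "laurent_of_poly N * f"]
    by (simp add: laurent_subst_mult[OF P] laurent_subst_of_poly[OF P] h_def)
  have "littlewood_product P (laurent_subst f P) (pcompose N P) = (if h = 0 then 0 else
      ?q powi ((int (degree N) - fls_subdegree h - int i) * int (degree P)))"
    unfolding littlewood_product_eq[OF P NP ndvd] frac laurent_subst_eq_0_iff[OF P]
      subdegree_laurent_subst[OF P] degree_pcompose
    by (simp add: algebra_simps)
  also have "\<dots> = littlewood_product [:0, 1:] f N ^ degree P"
    using P by (simp add: littlewood_product_eq[OF _ N] h_def power_int_mult)
  finally show ?thesis .
qed

text \<open>The products take values in \<open>{0} \<union> q\<^sup>\<int>\<close>, where \<open>q powi (- int l)\<close> is isolated.\<close>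

lemma adic_littlewood_inf_attained:
  fixes P :: "'a::field poly" and l :: nat
  defines "q \<equiv> real (norm_base TYPE('a))"
  assumes P: "degree P > 0" and inf: "adic_littlewood_inf P f = q powi (- int l)"
  obtains N where "N \<noteq> 0" "littlewood_product P f N = q powi (- int l)"
proof (rule ccontr)
  assume not_attained: "\<not> thesis"
  note attained = that
  have q: "q > 1" using norm_base_gt_1[where 'a = 'a] by (simp add: q_def)
  \<comment> \<open>If the infimum is missed, each product is a power of q strictly above q^(-l),
    hence at least the next power, and then so is the infimum.\<close>
  have "q powi (1 - int l) \<le> littlewood_product P f N" if "N \<noteq> 0" for N
  proof -
    obtain i M where N: "N = P ^ i * M" "\<not> P dvd M" using power_dvd_decompose[OF P \<open>N \<noteq> 0\<close>] .
    have "q powi (- int l) \<le> littlewood_product P f N"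
      using adic_littlewood_inf_le[OF \<open>N \<noteq> 0\<close>, of P f] inf by simp
    moreover have "littlewood_product P f N \<noteq> q powi (- int l)"
      using not_attained attained \<open>N \<noteq> 0\<close> by blast
    moreover have "0 < q powi (- int l)" using q by simp
    ultimately obtain e where "littlewood_product P f N = q powi e"
      "q powi (- int l) \<le> q powi e" "e \<noteq> - int l"
      using littlewood_product_eq[OF P N, of f] by (fastforce simp flip: q_def split: if_splits)
    then show ?thesis using q by (simp add: power_int_le_iff)
  qed
  then have "q powi (1 - int l) \<le> q powi (- int l)"
    using le_adic_littlewood_inf[of "q powi (1 - int l)" P f] inf by simp
  then show False using q by (simp add: power_int_le_iff)
qed

text \<open>Only a lower bound is assumed, so this serves both the exact value and
  positivity.\<close>

lemma adic_littlewood_inf_subst_ge: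
  fixes P :: "'a::field poly" and l :: nat
  defines "q \<equiv> real (norm_base TYPE('a))"
  assumes "degree P > 0" "q powi (- int l) \<le> adic_littlewood_inf [:0, 1:] f"
  shows "q powi (- int (l * degree P)) \<le> adic_littlewood_inf P (laurent_subst f P)"
  unfolding q_def
proof (intro le_adic_littlewood_inf littlewood_product_subst_ge)
  fix N :: "'a poly" assume "N \<noteq> 0"
  then show "real (norm_base TYPE('a)) powi (- int l) \<le> littlewood_product [:0, 1:] f N"
    using adic_littlewood_inf_le[of N "[:0, 1:]" f] assms by simp
qed (use assms in auto)

theorem theorem1p1p1:
  fixes l :: nat and P :: "'a::field poly" and \<Theta> :: "'a fls"
  assumes "irreducible P"
    and "\<forall>i\<le>0. \<Theta> $$ i = 0"
  shows "(adic_littlewood_inf [:0, 1:] \<Theta> = real (norm_base TYPE('a)) powi (- int l) \<longrightarrow>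
            adic_littlewood_inf P (laurent_subst \<Theta> P) =
              real (norm_base TYPE('a)) powi (- int (l * degree P))) \<and>
         (adic_littlewood_inf [:0, 1:] \<Theta> > 0 \<longrightarrow>
            adic_littlewood_inf P (laurent_subst \<Theta> P) > 0)"
proof (intro conjI impI)
  let ?q = "real (norm_base TYPE('a))"
  have q: "?q > 1" using norm_base_gt_1[where 'a = 'a] by simp
  \<comment> \<open>Over a field, an irreducible polynomial is neither zero nor a unit, hence not
    constant.\<close>
  have P: "degree P > 0"
    using assms(1) by (metis gr0I irreducible_def is_unit_iff_degree)
  show "adic_littlewood_inf P (laurent_subst \<Theta> P) = ?q powi (- int (l * degree P))"
    if inf: "adic_littlewood_inf [:0, 1:] \<Theta> = ?q powi (- int l)"
  proof (rule antisym)
    obtain N where N: "N \<noteq> 0" "littlewood_product [:0, 1:] \<Theta> N = ?q powi (- int l)"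
      by (rule adic_littlewood_inf_attained[OF _ inf]) auto
    have "pcompose N P \<noteq> 0" using N(1) P by (simp add: pcompose_eq_0_iff)
    then have "adic_littlewood_inf P (laurent_subst \<Theta> P) \<le> (?q powi (- int l)) ^ degree P"
      using adic_littlewood_inf_le littlewood_product_subst_pcompose[OF P N(1)] N(2) by metis
    then show "adic_littlewood_inf P (laurent_subst \<Theta> P) \<le> ?q powi (- int (l * degree P))"
      using power_int_mult[of ?q "- int l" "int (degree P)"] by simp
  qed (use adic_littlewood_inf_subst_ge[OF P] inf in simp)
  show "adic_littlewood_inf P (laurent_subst \<Theta> P) > 0" if pos: "adic_littlewood_inf [:0, 1:] \<Theta> > 0"
  proof -
    \<comment> \<open>By the Archimedean property some (1/q)^k lies below the positive infimum; the
      lower bound with this \<open>k\<close> in place of \<open>l\<close> carries over.\<close>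
    obtain k where "(1 / ?q) ^ k < adic_littlewood_inf [:0, 1:] \<Theta>"
      using real_arch_pow_inv[OF pos, of "1 / ?q"] q by auto
    then have "?q powi (- int k) \<le> adic_littlewood_inf [:0, 1:] \<Theta>"
      by (simp add: power_int_minus power_one_over inverse_eq_divide)
    then have "?q powi (- int (k * degree P)) \<le> adic_littlewood_inf P (laurent_subst \<Theta> P)"
      by (rule adic_littlewood_inf_subst_ge[OF P])
    moreover have "?q powi (- int (k * degree P)) > 0" using q by simp
    ultimately show ?thesis by linarith
  qed
qed

end
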